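(* For $1\le p,q\le\infty$ let $\mathcal{M}(p,q)$ be the space of Schur multipliers on $\mathcal{B}(\ell_p,\ell_q)$. (i) If $1\le q<p\le2$, then $\mathcal{M}(q,1)\nsubseteq\mathcal{M}(p,p)$. Consequently, for any $1\le r\le q$, $\mathcal{M}(q,r)\nsubseteq\mathcal{M}(p,p)$. (ii) If $2\le p<q\le r$, then $\mathcal{M}(r,q)\nsubseteq\mathcal{M}(p,p)$. (iii) If $1<q<2<p<+\infty$ or $1<p<2<q<+\infty$, then $\mathcal{M}(q,q)\nsubseteq\mathcal{M}(p,p)$.
   Context: Exponents are in $[1,\infty]$. A matrix $[a_{ij}]_{i,j\ge1}$ is regarded as the operator $x\mapsto\left(\sum_j a_{ij}x_j\right)_i$; it is in $\mathcal{B}(\ell_p,\ell_q)$ if this defines a bounded operator $\ell_p\to\ell_q$. A bounded family $(m_{ij})_{i,j\ge1}$ of complex numbers is a Schur multiplier on $\mathcal{B}(\ell_p,\ell_q)$ if for every matrix $[a_{ij}]$ in $\mathcal{B}(\ell_p,\ell_q)$ the matrix $[m_{ij}a_{ij}]$ is in $\mathcal{B}(\ell_p,\ell_q)$. *)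

theory Defs
  imports "HOL-Analysis.Analysis"
begin

text \<open>
  Sequences and matrices are indexed by \<^typ>\<open>nat\<close> starting from 0 instead of 1.
  Exponents are extended reals; the definitions are meaningful for exponents \<open>1 \<le> p \<le> \<infinity>\<close>.
\<close>

definition lp_space :: "ereal \<Rightarrow> (nat \<Rightarrow> complex) set" where
  "lp_space p =
     (if p = \<infinity> then {x. bounded (range x)}
      else {x. summable (\<lambda>n. norm (x n) powr real_of_ereal p)})"

definition lp_norm :: "ereal \<Rightarrow> (nat \<Rightarrow> complex) \<Rightarrow> real" where
  "lp_norm p x =
     (if p = \<infinity> then (SUP n. norm (x n))
      else (\<Sum>n. norm (x n) powr real_of_ereal p) powr (1 / real_of_ereal p))"

definition mat_apply :: "(nat \<Rightarrow> nat \<Rightarrow> complex) \<Rightarrow> (nat \<Rightarrow> complex) \<Rightarrow> nat \<Rightarrow> complex" where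
  "mat_apply a x = (\<lambda>i. \<Sum>j. a i j * x j)"

text \<open>
  Convergence of the row series is required explicitly, because \<^const>\<open>suminf\<close> has an
  unspecified value on divergent series.
\<close>

definition bounded_matrices :: "ereal \<Rightarrow> ereal \<Rightarrow> (nat \<Rightarrow> nat \<Rightarrow> complex) set" where
  "bounded_matrices p q =
     {a. (\<forall>x\<in>lp_space p. (\<forall>i. summable (\<lambda>j. a i j * x j)) \<and> mat_apply a x \<in> lp_space q) \<and>
         (\<exists>C. \<forall>x\<in>lp_space p. lp_norm q (mat_apply a x) \<le> C * lp_norm p x)}"

definition schur_multipliers :: "ereal \<Rightarrow> ereal \<Rightarrow> (nat \<Rightarrow> nat \<Rightarrow> complex) set" where
  "schur_multipliers p q =
     {m. (\<exists>C. \<forall>i j. norm (m i j) \<le> C) \<and>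
         (\<forall>a\<in>bounded_matrices p q. (\<lambda>i j. m i j * a i j) \<in> bounded_matrices p q)}"

end

theory Submission
  imports Defs "HOL-Library.Discrete_Functions"
begin

text \<open>
  If \<open>\<bar>m\<^sub>i\<^sub>j\<bar> \<le> c\<^sub>j\<close> with \<open>c\<close> in the dual of \<open>\<ell>\<^sub>q\<close>, then summing the columns of the Schur
  product by the triangle inequality shows \<open>m \<in> M(q,r)\<close> for every \<open>r\<close>. Let the signs \<open>\<epsilon>\<^sub>i\<^sub>j\<close> be
  given by the binary digits of \<open>i\<close>, so that the rows \<open>2\<^sup>n \<le> i < 2\<^sup>n\<^sup>+\<^sup>1\<close> run through all sign patterns
  on the first \<open>n\<close> columns, and take \<open>m\<^sub>i\<^sub>j = (j+1)\<^sup>-\<^sup>s \<epsilon>\<^sub>i\<^sub>j\<close> with \<open>s > 1 - 1/q\<close>. By Khintchine's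
  inequality the cancellation in \<open>\<epsilon>\<close> makes a suitable block matrix with entries of sign \<open>\<epsilon>\<^sub>i\<^sub>j\<close> bounded
  on \<open>\<ell>\<^sub>p\<close>; the Schur product with \<open>m\<close> has nonnegative entries, all cancellation is lost, and the
  product is unbounded as soon as \<open>s < min (1 - 1/p) (1/2)\<close>. Such an \<open>s\<close> exists when \<open>q < 2\<close> and
  \<open>q < p < \<infinity>\<close>. The transposed multiplier handles the remaining cases.
\<close>

subsection \<open>Sums of powers\<close>

text \<open>Both factors are scaled to norm one and Young's inequality is summed term by term. If
  \<open>A\<close> is infinite or one of the factors has norm zero, the scaling is impossible, but
  then the left side is 0.\<close>

lemma Holder_sum:
  fixes f g :: "'a \<Rightarrow> real"
  assumes pq: "p > 1" "q > 1" "1/p + 1/q = 1"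
    and f: "\<And>i. i \<in> A \<Longrightarrow> 0 \<le> f i" and g: "\<And>i. i \<in> A \<Longrightarrow> 0 \<le> g i"
  shows "(\<Sum>i\<in>A. f i * g i) \<le> (\<Sum>i\<in>A. f i powr p) powr (1/p) * (\<Sum>i\<in>A. g i powr q) powr (1/q)"
proof (cases "finite A \<and> (\<Sum>i\<in>A. f i powr p) \<noteq> 0 \<and> (\<Sum>i\<in>A. g i powr q) \<noteq> 0")
  case False
  then consider "infinite A" | "finite A" "(\<Sum>i\<in>A. f i powr p) = 0" | "finite A" "(\<Sum>i\<in>A. g i powr q) = 0"
    by blast
  then have "(\<Sum>i\<in>A. f i * g i) = 0"
  proof cases
    case 2
    then have "\<forall>i\<in>A. f i = 0" by (simp add: sum_nonneg_eq_0_iff)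
    then show ?thesis by simp
  next
    case 3
    then have "\<forall>i\<in>A. g i = 0" by (simp add: sum_nonneg_eq_0_iff)
    then show ?thesis by simp
  qed simp
  then show ?thesis by simp
next
  case True
  define F where "F = (\<Sum>i\<in>A. f i powr p)"
  define G where "G = (\<Sum>i\<in>A. g i powr q)"
  have "F \<ge> 0" "G \<ge> 0" unfolding F_def G_def by (auto intro: sum_nonneg)
  with True have FG: "F > 0" "G > 0" unfolding F_def G_def by linarith+
  define a where "a = F powr (1/p)"
  define b where "b = G powr (1/q)"
  have ab: "a > 0" "b > 0" "a powr p = F" "b powr q = G"
    using FG pq by (auto simp: a_def b_def powr_powr)
  have "(\<Sum>i\<in>A. (f i / a) * (g i / b)) \<le> (\<Sum>i\<in>A. (f i / a) powr p / p + (g i / b) powr q / q)"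
    using pq f g ab by (intro sum_mono Youngs_inequality) auto
  also have "\<dots> = (\<Sum>i\<in>A. f i powr p / F / p) + (\<Sum>i\<in>A. g i powr q / G / q)"
    using f g ab by (simp add: sum.distrib powr_divide)
  also have "\<dots> = 1"
    using FG pq(3) by (simp add: F_def G_def flip: sum_divide_distrib)
  finally have "(\<Sum>i\<in>A. f i * g i) / (a * b) \<le> 1"
    by (simp add: sum_divide_distrib)
  then show ?thesis using ab by (simp add: a_def b_def F_def G_def)
qed

lemma Holder_suminf:
  fixes f g :: "nat \<Rightarrow> real"
  assumes pq: "p > 1" "q > 1" "1/p + 1/q = 1"
    and f: "\<And>i. 0 \<le> f i" and g: "\<And>i. 0 \<le> g i"
    and sf: "summable (\<lambda>i. f i powr p)" and sg: "summable (\<lambda>i. g i powr q)"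
  shows "summable (\<lambda>i. f i * g i)"
    and "(\<Sum>i. f i * g i) \<le> (\<Sum>i. f i powr p) powr (1/p) * (\<Sum>i. g i powr q) powr (1/q)"
proof -
  have *: "(\<Sum>i<n. f i * g i) \<le> (\<Sum>i. f i powr p) powr (1/p) * (\<Sum>i. g i powr q) powr (1/q)" for n
  proof -
    have "(\<Sum>i<n. f i * g i) \<le> (\<Sum>i<n. f i powr p) powr (1/p) * (\<Sum>i<n. g i powr q) powr (1/q)"
      using f g by (intro Holder_sum pq) auto
    also have "\<dots> \<le> (\<Sum>i. f i powr p) powr (1/p) * (\<Sum>i. g i powr q) powr (1/q)"
      using pq sf sg
      by (intro mult_mono powr_mono2 sum_le_suminf) (auto intro: sum_nonneg)
    finally show ?thesis .
  qed
  show s: "summable (\<lambda>i. f i * g i)"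
    using f g * by (intro summableI_nonneg_bounded) auto
  show "(\<Sum>i. f i * g i) \<le> (\<Sum>i. f i powr p) powr (1/p) * (\<Sum>i. g i powr q) powr (1/q)"
    using s * by (rule suminf_le_const)
qed

text \<open>Hoelder applied to the splitting \<tau> = \<tau>^(1/r') \<tau>^(1/r), with r' conjugate
  to r. The weights need not have total mass 1, so their mass appears to the power r - 1. This
  inequality later does the work of Minkowski's.\<close>

lemma Jensen_powr_sum:
  fixes \<tau> \<beta> :: "'a \<Rightarrow> real"
  assumes r: "r \<ge> 1" and \<tau>: "\<And>i. i \<in> A \<Longrightarrow> 0 \<le> \<tau> i" and \<beta>: "\<And>i. i \<in> A \<Longrightarrow> 0 \<le> \<beta> i"
  shows "(\<Sum>i\<in>A. \<tau> i * \<beta> i) powr r \<le> (\<Sum>i\<in>A. \<tau> i) powr (r - 1) * (\<Sum>i\<in>A. \<tau> i * \<beta> i powr r)"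
proof (cases "(\<Sum>i\<in>A. \<tau> i) = 0 \<or> r = 1")
  case True
  then consider "(\<Sum>i\<in>A. \<tau> i) = 0" | "r = 1" "(\<Sum>i\<in>A. \<tau> i) \<noteq> 0" by blast
  then show ?thesis
  proof cases
    case 1
    then have "(\<Sum>i\<in>A. \<tau> i * \<beta> i) = 0"
      using \<tau> by (cases "finite A") (auto simp: sum_nonneg_eq_0_iff)
    then show ?thesis using 1 by simp
  next
    case 2
    have "(\<Sum>i\<in>A. \<tau> i * \<beta> i) \<ge> 0" "(\<Sum>i\<in>A. \<tau> i * \<beta> i powr 1) = (\<Sum>i\<in>A. \<tau> i * \<beta> i)"
      using \<tau> \<beta> by (auto intro!: sum_nonneg sum.cong)
    then show ?thesis using 2 sum_nonneg[of A \<tau>] \<tau> by simp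
  qed
next
  case False
  define r' where "r' = r / (r - 1)"
  have r1: "r > 1" using r False by simp
  then have r': "r' > 1" "1/r + 1/r' = 1" by (auto simp: r'_def field_simps)
  define X where "X = (\<Sum>i\<in>A. \<tau> i)"
  have X: "X > 0" using False sum_nonneg[of A \<tau>] \<tau> by (auto simp: X_def less_le)
  have "(\<Sum>i\<in>A. \<tau> i * \<beta> i) = (\<Sum>i\<in>A. \<tau> i powr (1/r') * (\<tau> i powr (1/r) * \<beta> i))"
    using \<tau> r'(2) by (intro sum.cong refl) (auto simp: algebra_simps simp flip: mult.assoc powr_add)
  also have "\<dots> \<le> (\<Sum>i\<in>A. (\<tau> i powr (1/r')) powr r') powr (1/r') *
      (\<Sum>i\<in>A. (\<tau> i powr (1/r) * \<beta> i) powr r) powr (1/r)"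
    using r' r1 \<beta> by (intro Holder_sum) auto
  also have "\<dots> = X powr (1/r') * (\<Sum>i\<in>A. \<tau> i * \<beta> i powr r) powr (1/r)"
    using r' r1 \<tau> \<beta> by (simp add: powr_powr powr_mult X_def)
  finally have "(\<Sum>i\<in>A. \<tau> i * \<beta> i) powr r \<le> (X powr (1/r') * (\<Sum>i\<in>A. \<tau> i * \<beta> i powr r) powr (1/r)) powr r"
    using r1 \<tau> \<beta> by (intro powr_mono2) (auto intro: sum_nonneg)
  also have "\<dots> = X powr (r - 1) * (\<Sum>i\<in>A. \<tau> i * \<beta> i powr r)"
  proof -
    have "1/r' * r = r - 1" using r1 by (simp add: r'_def)
    moreover have "(\<Sum>i\<in>A. \<tau> i * \<beta> i powr r) \<ge> 0" using \<tau> by (auto intro: sum_nonneg)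
    ultimately show ?thesis using r1 by (simp add: powr_mult powr_powr)
  qed
  finally show ?thesis by (simp add: X_def)
qed

text \<open>Each \<open>x i powr p\<close> is at most the full sum S, so x^r = x^p (x^p)^(r/p - 1)
  is at most x^p S^(r/p - 1), and summation gives S^(r/p).\<close>

lemma sum_powr_norm_antimono:
  fixes x :: "'a \<Rightarrow> real"
  assumes p: "0 < p" "p \<le> r" and x: "\<And>i. i \<in> A \<Longrightarrow> 0 \<le> x i" and A: "finite A"
  shows "(\<Sum>i\<in>A. x i powr r) powr (p / r) \<le> (\<Sum>i\<in>A. x i powr p)"
proof -
  define S where "S = (\<Sum>i\<in>A. x i powr p)"
  have S0: "S \<ge> 0" unfolding S_def by (auto intro: sum_nonneg)
  have "x i powr r \<le> x i powr p * S powr (r / p - 1)" if i: "i \<in> A" for i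
  proof -
    have "x i powr r = x i powr p * (x i powr p) powr (r / p - 1)"
      using p by (simp add: powr_powr algebra_simps flip: powr_add)
    also have "\<dots> \<le> x i powr p * S powr (r / p - 1)"
      using p i A unfolding S_def
      by (intro mult_left_mono powr_mono2 member_le_sum) auto
    finally show ?thesis .
  qed
  then have "(\<Sum>i\<in>A. x i powr r) \<le> S * S powr (r / p - 1)"
    unfolding S_def sum_distrib_right by (rule sum_mono)
  also have "\<dots> = S powr (r / p)"
    using S0 p by (cases "S = 0") (auto simp: powr_diff)
  finally have "(\<Sum>i\<in>A. x i powr r) powr (p / r) \<le> (S powr (r / p)) powr (p / r)"
    using p by (intro powr_mono2) (auto intro: sum_nonneg)
  also have "\<dots> = S" using p S0 by (simp add: powr_powr)
  finally show ?thesis by (simp add: S_def)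
qed

subsection \<open>Khintchine inequality for binary digits\<close>

text \<open>These are Rademacher signs: for \<open>i < 2 ^ n\<close> the vectors of the first n
  signs run through every pattern exactly once, so averaging over i is averaging over independent
  signs.\<close>

definition sgn_bit :: "nat \<Rightarrow> nat \<Rightarrow> real" where
  "sgn_bit i j = (if bit i j then -1 else 1)"

lemma sgn_bit_square [simp]: "sgn_bit i j * sgn_bit i j = 1"
  and abs_sgn_bit [simp]: "\<bar>sgn_bit i j\<bar> = 1"
  by (auto simp: sgn_bit_def)

lemma bit_power_add:
  fixes i :: nat
  assumes "i < 2 ^ n"
  shows "j < n \<Longrightarrow> bit (2 ^ n + i) j = bit i j" and "bit (2 ^ n + i) n" and "\<not> bit i n"
proof -
  have n: "\<not> bit i n" using assms by (metis bit_take_bit_iff less_irrefl take_bit_nat_eq_self_iff)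
  have "\<not> bit (2 ^ n) j \<or> \<not> bit i j" for j
    using n by (auto simp: bit_exp_iff)
  then have *: "bit (2 ^ n + i) j \<longleftrightarrow> bit (2 ^ n :: nat) j \<or> bit i j" for j
    by (subst disjunctive_add) (auto simp: bit_or_iff)
  show "j < n \<Longrightarrow> bit (2 ^ n + i) j = bit i j" "bit (2 ^ n + i) n" "\<not> bit i n"
    using n by (auto simp: * bit_exp_iff)
qed

lemma sum_dyadic_split:
  fixes f :: "nat \<Rightarrow> 'a::comm_monoid_add"
  shows "(\<Sum>i<2 ^ Suc n. f i) = (\<Sum>i<2 ^ n. f i) + (\<Sum>i<2 ^ n. f (2 ^ n + i))"
proof -
  have "{..<2 ^ Suc n} = {..<2 ^ n} \<union> {2 ^ n..<2 ^ n + 2 ^ n :: nat}" by auto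
  then have "(\<Sum>i<2 ^ Suc n. f i) = (\<Sum>i<2 ^ n. f i) + (\<Sum>i=2 ^ n..<2 ^ n + 2 ^ n. f i)"
    by (metis finite_atLeastLessThan finite_lessThan ivl_disj_int_one(2) sum.union_disjoint)
  also have "(\<Sum>i=2 ^ n..<2 ^ n + 2 ^ n. f i) = (\<Sum>i<2 ^ n. f (2 ^ n + i))"
    using sum.shift_bounds_nat_ivl[of f 0 "2 ^ n" "2 ^ n"] by (simp add: lessThan_atLeast0 add.commute)
  finally show ?thesis .
qed

text \<open>Decomposes a range into the blocks 2^k, ..., 2^(k+1) - 1; the index 0 lies in none of
  them.\<close>

lemma sum_dyadic_blocks:
  fixes f :: "nat \<Rightarrow> 'a::comm_monoid_add"
  shows "(\<Sum>i<2 ^ n. f i) = f 0 + (\<Sum>k<n. \<Sum>i<2 ^ k. f (2 ^ k + i))"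
proof (induction n)
  case (Suc n)
  then show ?case by (subst sum_dyadic_split) (simp add: add.assoc)
qed simp

text \<open>Independence of the signs in the form of a factorising generating function. Halving the
  range separates the patterns whose digit n is clear from those whose digit n is set, and the lower
  digits agree in both halves.\<close>

lemma sum_exp_sgn_bit:
  fixes y :: "nat \<Rightarrow> real"
  shows "(\<Sum>i<2 ^ n. exp (\<Sum>j<n. sgn_bit i j * y j)) = (\<Prod>j<n. exp (y j) + exp (- y j))"
proof (induction n)
  case (Suc n)
  have "(\<Sum>i<2 ^ n. exp (\<Sum>j<Suc n. sgn_bit i j * y j)) =
      (\<Sum>i<2 ^ n. exp (\<Sum>j<n. sgn_bit i j * y j) * exp (y n))"
    by (intro sum.cong refl) (auto simp: sgn_bit_def bit_power_add exp_add)
  moreover have "(\<Sum>i<2 ^ n. exp (\<Sum>j<Suc n. sgn_bit (2 ^ n + i) j * y j)) =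
      (\<Sum>i<2 ^ n. exp (\<Sum>j<n. sgn_bit i j * y j) * exp (- y n))"
  proof (intro sum.cong refl)
    fix i :: nat assume "i \<in> {..<2 ^ n}"
    then have i: "i < 2 ^ n" by simp
    have "(\<Sum>j<n. sgn_bit (2 ^ n + i) j * y j) = (\<Sum>j<n. sgn_bit i j * y j)"
      using i by (intro sum.cong) (auto simp: sgn_bit_def bit_power_add)
    then show "exp (\<Sum>j<Suc n. sgn_bit (2 ^ n + i) j * y j) = exp (\<Sum>j<n. sgn_bit i j * y j) * exp (- y n)"
      using bit_power_add(2)[OF i] by (simp add: sgn_bit_def flip: exp_add)
  qed
  ultimately show ?case
    unfolding sum_dyadic_split
    by (simp only: Suc.IH prod.lessThan_Suc distrib_left flip: sum_distrib_right)
qed simp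

text \<open>A sub-Gaussian bound for cosh. The restriction to small y lets quadratic bounds for exp
  suffice.\<close>

lemma exp_add_exp_minus_le:
  fixes y :: real
  assumes "\<bar>y\<bar> \<le> 1"
  shows "exp y + exp (- y) \<le> 2 * exp (y\<^sup>2)"
proof -
  have *: "exp t + exp (- t) \<le> 2 * (1 + t\<^sup>2)" if t: "0 \<le> t" "t \<le> 1" for t :: real
  proof -
    have "exp t \<le> 1 + t + t\<^sup>2" using t exp_bound by blast
    moreover have "exp (- t) \<le> 1 - t + t\<^sup>2"
    proof -
      \<comment> \<open>The product on the right equals 1 + t^3.\<close>
      have "1 \<le> (1 - t + t\<^sup>2) * (1 + t)"
        using t by (simp add: algebra_simps power2_eq_square)
      also have "\<dots> \<le> (1 - t + t\<^sup>2) * exp t"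
        using t by (intro mult_left_mono exp_ge_add_one_self) auto
      finally show ?thesis by (simp add: exp_minus field_simps)
    qed
    ultimately show ?thesis by simp
  qed
  have "exp y + exp (- y) = exp \<bar>y\<bar> + exp (- \<bar>y\<bar>)" by (simp add: abs_if)
  also have "\<dots> \<le> 2 * (1 + \<bar>y\<bar>\<^sup>2)" using assms by (intro *) auto
  also have "\<dots> \<le> 2 * exp (y\<^sup>2)"
    unfolding power2_abs by (rule mult_left_mono[OF exp_ge_add_one_self]) simp
  finally show ?thesis .
qed

text \<open>Rounding p up gives an integer power, which is a single term of the exponential series
  up to a factorial. The extra 1 in the constant covers arguments of modulus at most 1.\<close>

lemma powr_le_exp:
  fixes u p :: real
  assumes "p \<ge> 0"
  shows "\<bar>u\<bar> powr p \<le> (1 + fact (nat \<lceil>p\<rceil>)) * (exp u + exp (- u))"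
proof -
  define k where "k = nat \<lceil>p\<rceil>"
  have e: "exp \<bar>u\<bar> \<le> exp u + exp (- u)" by (simp add: abs_if)
  have e1: "1 \<le> exp \<bar>u\<bar>" by simp
  have "\<bar>u\<bar> powr p \<le> 1 + \<bar>u\<bar> ^ k"
  proof (cases "\<bar>u\<bar> \<le> 1")
    case True
    then have "\<bar>u\<bar> powr p \<le> 1" using assms by (simp add: powr_le1)
    then show ?thesis by (simp add: add_increasing2)
  next
    case False
    have "\<bar>u\<bar> powr p \<le> \<bar>u\<bar> powr real k"
      using False by (intro powr_mono) (auto simp: k_def of_nat_ceiling)
    also have "\<dots> = \<bar>u\<bar> ^ k" using False by (simp add: powr_realpow)
    finally show ?thesis by simp
  qed
  also have "\<bar>u\<bar> ^ k \<le> fact k * exp \<bar>u\<bar>"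
  proof -
    have "(\<Sum>n\<in>{k}. \<bar>u\<bar> ^ n /\<^sub>R fact n) \<le> exp \<bar>u\<bar>"
      unfolding exp_def by (intro sum_le_suminf summable_exp_generic) auto
    then show ?thesis by (simp add: field_simps)
  qed
  also have "1 + fact k * exp \<bar>u\<bar> \<le> (1 + fact k) * exp \<bar>u\<bar>"
    using e1 by (simp add: algebra_simps)
  also have "\<dots> \<le> (1 + fact k) * (exp u + exp (- u))"
    using e by (intro mult_left_mono) auto
  finally show ?thesis by (simp add: k_def)
qed

text \<open>The last factor is the constant of \<open>powr_le_exp\<close>, 2 counts the two
  exponentials there, and \<open>exp 1\<close> bounds the generating function of a normalised vector
  divided by 2^n.\<close>

definition khintchine_const :: "real \<Rightarrow> real" where
  "khintchine_const p = 2 * exp 1 * (1 + fact (nat \<lceil>p\<rceil>))"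

text \<open>Homogeneity reduces to coefficients z with square sum 1. The power is then dominated by
  exponentials, whose sum over all patterns is a product of at most 2^n exp (\<Sum> z_j^2).\<close>

lemma Khintchine_real:
  fixes y :: "nat \<Rightarrow> real"
  assumes p: "p > 0"
  shows "(\<Sum>i<2 ^ n. \<bar>\<Sum>j<n. sgn_bit i j * y j\<bar> powr p)
           \<le> khintchine_const p * 2 ^ n * (\<Sum>j<n. (y j)\<^sup>2) powr (p / 2)"
proof (cases "(\<Sum>j<n. (y j)\<^sup>2) = 0")
  case True
  then have "\<forall>j<n. y j = 0" by (simp add: sum_nonneg_eq_0_iff)
  then show ?thesis using True by simp
next
  case False
  define R where "R = (\<Sum>j<n. (y j)\<^sup>2)"
  have R: "R > 0" using False sum_nonneg[of "{..<n}" "\<lambda>j. (y j)\<^sup>2"] by (auto simp: R_def less_le)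
  define z where "z = (\<lambda>j. y j / sqrt R)"
  have z1: "(\<Sum>j<n. (z j)\<^sup>2) = 1"
    using R by (simp add: z_def power_divide R_def flip: sum_divide_distrib)
  have zle: "\<bar>z j\<bar> \<le> 1" if "j < n" for j
  proof -
    have "(z j)\<^sup>2 \<le> (\<Sum>j<n. (z j)\<^sup>2)" using that by (intro member_le_sum) auto
    then show ?thesis using z1 by (simp add: abs_square_le_1)
  qed
  define D :: real where "D = 1 + fact (nat \<lceil>p\<rceil>)"
  define S where "S = (\<lambda>i. \<Sum>j<n. sgn_bit i j * z j)"
  have D: "D \<ge> 0" by (simp add: D_def)
  have P: "(\<Prod>j<n. exp (z j) + exp (- z j)) \<le> 2 ^ n * exp 1"
  proof -
    have "(\<Prod>j<n. exp (z j) + exp (- z j)) \<le> (\<Prod>j<n. 2 * exp ((z j)\<^sup>2))"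
      by (intro prod_mono conjI exp_add_exp_minus_le zle) (auto intro: add_nonneg_nonneg)
    also have "\<dots> = 2 ^ n * exp 1" by (simp add: prod.distrib z1 flip: exp_sum)
    finally show ?thesis .
  qed
  have "(\<Sum>i<2 ^ n. \<bar>S i\<bar> powr p) \<le> (\<Sum>i<2 ^ n. D * (exp (S i) + exp (- S i)))"
    unfolding D_def using p by (intro sum_mono powr_le_exp) auto
  also have "\<dots> = D * ((\<Sum>i<2 ^ n. exp (S i)) + (\<Sum>i<2 ^ n. exp (- S i)))"
    by (simp add: sum.distrib flip: sum_distrib_left)
  also have "(\<Sum>i<2 ^ n. exp (S i)) = (\<Prod>j<n. exp (z j) + exp (- z j))"
    unfolding S_def by (rule sum_exp_sgn_bit)
  also have "(\<Sum>i<2 ^ n. exp (- S i)) = (\<Prod>j<n. exp (z j) + exp (- z j))"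
    using sum_exp_sgn_bit[where n = n and y = "\<lambda>j. - z j"] by (simp add: S_def add.commute flip: sum_negf)
  also have "D * ((\<Prod>j<n. exp (z j) + exp (- z j)) + (\<Prod>j<n. exp (z j) + exp (- z j)))
      \<le> D * (2 ^ n * exp 1 + 2 ^ n * exp 1)"
    using P D by (intro mult_left_mono add_mono)
  also have "\<dots> = khintchine_const p * 2 ^ n"
    by (simp add: D_def khintchine_const_def)
  finally have *: "(\<Sum>i<2 ^ n. \<bar>S i\<bar> powr p) \<le> khintchine_const p * 2 ^ n" .
  have "(\<Sum>i<2 ^ n. \<bar>\<Sum>j<n. sgn_bit i j * y j\<bar> powr p) = (\<Sum>i<2 ^ n. \<bar>S i\<bar> powr p * R powr (p / 2))"
  proof (intro sum.cong refl)
    fix i :: nat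
    have "(\<Sum>j<n. sgn_bit i j * y j) = S i * sqrt R"
      using R by (simp add: S_def z_def sum_distrib_right)
    then show "\<bar>\<Sum>j<n. sgn_bit i j * y j\<bar> powr p = \<bar>S i\<bar> powr p * R powr (p / 2)"
      using R by (simp add: abs_mult powr_mult powr_powr flip: powr_half_sqrt)
  qed
  also have "\<dots> \<le> khintchine_const p * 2 ^ n * R powr (p / 2)"
    unfolding sum_distrib_right[symmetric] using * by (intro mult_right_mono) auto
  finally show ?thesis by (simp add: R_def)
qed

text \<open>The real case is applied to real and imaginary parts, using |z| \<le> 2 max(|Re z|, |Im
  z|).\<close>

lemma Khintchine_complex:
  fixes x :: "nat \<Rightarrow> complex"
  assumes p: "p > 0"
  shows "(\<Sum>i<2 ^ n. norm (\<Sum>j<n. of_real (sgn_bit i j) * x j) powr p)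
           \<le> 2 powr (p + 1) * khintchine_const p * 2 ^ n * (\<Sum>j<n. (norm (x j))\<^sup>2) powr (p / 2)"
proof -
  have K: "khintchine_const p \<ge> 0" by (simp add: khintchine_const_def)
  define E where "E = khintchine_const p * 2 ^ n * (\<Sum>j<n. (norm (x j))\<^sup>2) powr (p / 2)"
  have part: "(\<Sum>i<2 ^ n. \<bar>\<Sum>j<n. sgn_bit i j * y j\<bar> powr p) \<le> E"
    if "\<And>j. \<bar>y j\<bar> \<le> norm (x j)" for y
  proof -
    have "(y j)\<^sup>2 \<le> (norm (x j))\<^sup>2" for j
      using power_mono[OF that[of j], of 2] by simp
    then have "(\<Sum>j<n. (y j)\<^sup>2) powr (p / 2) \<le> (\<Sum>j<n. (norm (x j))\<^sup>2) powr (p / 2)"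
      using p by (intro powr_mono2 sum_mono) (auto intro: sum_nonneg)
    then show ?thesis
      unfolding E_def using Khintchine_real[OF p, where n = n and y = y] K
      by (smt (verit, best) mult_left_mono mult_nonneg_nonneg zero_le_power)
  qed
  have le: "norm z powr p \<le> 2 powr p * (\<bar>Re z\<bar> powr p + \<bar>Im z\<bar> powr p)" for z :: complex
  proof -
    have "norm z \<le> 2 * max \<bar>Re z\<bar> \<bar>Im z\<bar>" using cmod_le[of z] by linarith
    then have "norm z powr p \<le> (2 * max \<bar>Re z\<bar> \<bar>Im z\<bar>) powr p"
      using p by (intro powr_mono2) auto
    also have "\<dots> = 2 powr p * (max \<bar>Re z\<bar> \<bar>Im z\<bar>) powr p" by (simp add: powr_mult)
    also have "\<dots> \<le> 2 powr p * (\<bar>Re z\<bar> powr p + \<bar>Im z\<bar> powr p)"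
      by (intro mult_left_mono) (auto simp: max_def)
    finally show ?thesis .
  qed
  have "(\<Sum>i<2 ^ n. norm (\<Sum>j<n. of_real (sgn_bit i j) * x j) powr p) \<le>
      (\<Sum>i<2 ^ n. 2 powr p * (\<bar>\<Sum>j<n. sgn_bit i j * Re (x j)\<bar> powr p + \<bar>\<Sum>j<n. sgn_bit i j * Im (x j)\<bar> powr p))"
  proof (intro sum_mono)
    fix i :: nat
    show "norm (\<Sum>j<n. of_real (sgn_bit i j) * x j) powr p \<le> 2 powr p *
       (\<bar>\<Sum>j<n. sgn_bit i j * Re (x j)\<bar> powr p + \<bar>\<Sum>j<n. sgn_bit i j * Im (x j)\<bar> powr p)"
      using le[of "\<Sum>j<n. of_real (sgn_bit i j) * x j"] by simp
  qed
  also have "\<dots> \<le> 2 powr p * (E + E)"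
    unfolding sum_distrib_left[symmetric] sum.distrib
    by (intro mult_left_mono add_mono part) (auto simp: abs_Re_le_cmod abs_Im_le_cmod)
  also have "\<dots> = 2 powr (p + 1) * khintchine_const p * 2 ^ n * (\<Sum>j<n. (norm (x j))\<^sup>2) powr (p / 2)"
    by (simp add: E_def powr_add)
  finally show ?thesis .
qed

text \<open>Compares the l_2 and l_p norms on n coordinates. For p \<le> 2 monotonicity of the norms
  costs nothing; for p > 2 Jensen with unit weights costs n^(p/2 - 1).\<close>

lemma sum_squares_powr_le:
  fixes x :: "nat \<Rightarrow> real"
  assumes p: "p > 0" and x: "\<And>j. x j \<ge> 0"
  shows "(\<Sum>j<n. (x j)\<^sup>2) powr (p / 2) \<le> real n powr (p * max 0 (1/2 - 1/p)) * (\<Sum>j<n. x j powr p)"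
proof (cases "p \<le> 2")
  case True
  then have "1/2 - 1/p \<le> 0" using p by (simp add: field_simps)
  moreover have "(\<Sum>j<n. (x j)\<^sup>2) powr (p / 2) \<le> (\<Sum>j<n. x j powr p)"
    using sum_powr_norm_antimono[of p 2 "{..<n}" x] p True x by simp
  \<comment> \<open>\<open>0 powr 0\<close> is 0, so the power of n equals 1 only for positive n;
    for n = 0 both sides vanish.\<close>
  ultimately show ?thesis by (cases "n = 0") auto
next
  case False
  have "(\<Sum>j<n. (x j)\<^sup>2) powr (p / 2) \<le> real n powr (p / 2 - 1) * (\<Sum>j<n. (x j)\<^sup>2 powr (p / 2))"
    using Jensen_powr_sum[of "p / 2" "{..<n}" "\<lambda>_. 1" "\<lambda>j. (x j)\<^sup>2"] False by simp
  also have "(\<Sum>j<n. (x j)\<^sup>2 powr (p / 2)) = (\<Sum>j<n. x j powr p)"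
  proof (intro sum.cong refl)
    fix j
    have "(x j)\<^sup>2 = x j powr 2" using x by simp
    then show "(x j)\<^sup>2 powr (p / 2) = x j powr p" by (simp only: powr_powr) simp
  qed
  also have "p / 2 - 1 = p * max 0 (1/2 - 1/p)" using False by (auto simp: max_def field_simps)
  finally show ?thesis .
qed

subsection \<open>Bounded matrices and Schur multipliers\<close>

lemma lp_space_ereal [simp]:
  "x \<in> lp_space (ereal p) \<longleftrightarrow> summable (\<lambda>n. norm (x n) powr p)"
  by (simp add: lp_space_def)

lemma lp_norm_ereal [simp]:
  "lp_norm (ereal p) x = (\<Sum>n. norm (x n) powr p) powr (1 / p)"
  by (simp add: lp_norm_def)

lemma lp_space_infinity [simp]: "x \<in> lp_space \<infinity> \<longleftrightarrow> bounded (range x)"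
  by (simp add: lp_space_def)

lemma lp_norm_infinity [simp]: "lp_norm \<infinity> x = (SUP n. norm (x n))"
  by (simp add: lp_norm_def)

lemma norm_le_lp_norm:
  assumes "1 \<le> p" "x \<in> lp_space p"
  shows "norm (x i) \<le> lp_norm p x"
proof (cases p)
  case (real r)
  with assms have r: "r \<ge> 1" and s: "summable (\<lambda>n. norm (x n) powr r)" by auto
  have "norm (x i) powr r = (\<Sum>n\<in>{i}. norm (x n) powr r)" by simp
  also have "\<dots> \<le> (\<Sum>n. norm (x n) powr r)" using s by (intro sum_le_suminf) auto
  finally have "(norm (x i) powr r) powr (1 / r) \<le> (\<Sum>n. norm (x n) powr r) powr (1 / r)"
    using r by (intro powr_mono2) auto
  then show ?thesis using r real by (simp add: powr_powr)
next
  case PInf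
  with assms have "bdd_above (range (\<lambda>n. norm (x n)))"
    by (auto simp: bounded_iff bdd_above_def)
  then show ?thesis using PInf by (auto intro: cSUP_upper)
qed (use assms in auto)

lemma lp_norm_nonneg: "1 \<le> p \<Longrightarrow> x \<in> lp_space p \<Longrightarrow> 0 \<le> lp_norm p x"
  using norm_le_lp_norm[of p x 0] norm_ge_zero order_trans by blast

lemma lp_partial_sum_le:
  assumes "p > 0" "x \<in> lp_space (ereal p)"
  shows "(\<Sum>i<n. norm (x i) powr p) \<le> lp_norm (ereal p) x powr p"
proof -
  have "(\<Sum>i<n. norm (x i) powr p) \<le> (\<Sum>i. norm (x i) powr p)"
    using assms by (intro sum_le_suminf) auto
  then show ?thesis using assms by (simp add: powr_powr suminf_nonneg)
qed

text \<open>Lets every later norm estimate be carried out on finite sums, membership in the space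
  included.\<close>

lemma lp_boundI:
  assumes "p > 0" "B \<ge> 0" and le: "\<And>n. (\<Sum>i<n. norm (x i) powr p) \<le> B powr p"
  shows "x \<in> lp_space (ereal p)" and "lp_norm (ereal p) x \<le> B"
proof -
  have s: "summable (\<lambda>i. norm (x i) powr p)"
    using le by (intro summableI_nonneg_bounded) auto
  then show "x \<in> lp_space (ereal p)" by simp
  have "(\<Sum>i. norm (x i) powr p) \<le> B powr p" by (rule suminf_le_const[OF s le])
  then have "(\<Sum>i. norm (x i) powr p) powr (1 / p) \<le> (B powr p) powr (1 / p)"
    using assms s by (intro powr_mono2) (auto intro: suminf_nonneg)
  then show "lp_norm (ereal p) x \<le> B" using assms by (simp add: powr_powr)
qed

lemma lp_dominated:
  assumes p: "1 \<le> p" and y: "y \<in> lp_space p" and T: "0 \<le> T"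
    and le: "\<And>i. norm (x i) \<le> T * norm (y i)"
  shows "x \<in> lp_space p" and "lp_norm p x \<le> T * lp_norm p y"
proof -
  have "x \<in> lp_space p \<and> lp_norm p x \<le> T * lp_norm p y"
  proof (cases p)
    case (real r)
    with p have r: "r \<ge> 1" by simp
    have "(\<Sum>i<n. norm (x i) powr r) \<le> (T * lp_norm p y) powr r" for n
    proof -
      have "(\<Sum>i<n. norm (x i) powr r) \<le> (\<Sum>i<n. (T * norm (y i)) powr r)"
        using r le by (intro sum_mono powr_mono2) auto
      also have "\<dots> = T powr r * (\<Sum>i<n. norm (y i) powr r)"
        using T by (simp add: powr_mult sum_distrib_left)
      also have "\<dots> \<le> T powr r * lp_norm p y powr r"
        using r y real by (intro mult_left_mono) (auto simp del: lp_norm_ereal intro!: lp_partial_sum_le)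
      also have "\<dots> = (T * lp_norm p y) powr r"
        using T lp_norm_nonneg[OF p y] by (simp add: powr_mult)
      finally show ?thesis .
    qed
    then show ?thesis
      using lp_boundI[of r "T * lp_norm p y" x] r T lp_norm_nonneg[OF p y] real by auto
  next
    case PInf
    have *: "norm (x i) \<le> T * lp_norm p y" for i
      using le[of i] mult_left_mono[OF norm_le_lp_norm[OF p y, of i] T] by linarith
    then show ?thesis using PInf by (auto simp: bounded_iff intro!: cSUP_least)
  qed (use p in auto)
  then show "x \<in> lp_space p" and "lp_norm p x \<le> T * lp_norm p y" by auto
qed

lemma lp_unit_vector:
  assumes "q > 0"
  shows "(\<lambda>n. if n = j then 1 else 0) \<in> lp_space (ereal q)"
    and "lp_norm (ereal q) (\<lambda>n. if n = j then 1 else 0) = 1"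
proof -
  have eq: "(\<lambda>n. norm (if n = j then 1 else 0 :: complex) powr q) = (\<lambda>n. if n = j then 1 else 0)"
    by auto
  have s: "(\<lambda>n. if n = j then 1 else 0 :: real) sums 1" using sums_single[of j "\<lambda>_. 1 :: real"] by simp
  show "(\<lambda>n. if n = j then 1 else 0) \<in> lp_space (ereal q)"
    unfolding lp_space_ereal eq using s by (rule sums_summable)
  show "lp_norm (ereal q) (\<lambda>n. if n = j then 1 else 0) = 1"
    unfolding lp_norm_ereal eq using sums_unique[OF s] by simp
qed

lemma mat_apply_unit_vector: "mat_apply a (\<lambda>n. if n = j then 1 else 0) i = a i j"
proof -
  have "(\<lambda>k. a i k * (if k = j then 1 else 0)) = (\<lambda>k. if k = j then a i k else 0)" by auto
  then show ?thesis
    unfolding mat_apply_def using sums_unique[OF sums_single[of j "a i"]] by simp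
qed

section \<open>Bounded matrices and absolute convergence of their rows\<close>

lemma bounded_matricesI:
  assumes "\<And>x i. x \<in> lp_space p \<Longrightarrow> summable (\<lambda>j. a i j * x j)"
    and "\<And>x. x \<in> lp_space p \<Longrightarrow> mat_apply a x \<in> lp_space q"
    and "\<And>x. x \<in> lp_space p \<Longrightarrow> lp_norm q (mat_apply a x) \<le> C * lp_norm p x"
  shows "a \<in> bounded_matrices p q"
  unfolding bounded_matrices_def using assms by (intro CollectI conjI exI[of _ C] ballI allI)

lemma bounded_matricesE:
  assumes "a \<in> bounded_matrices p q" "1 \<le> p"
  obtains C where "C \<ge> 0"
    and "\<And>x i. x \<in> lp_space p \<Longrightarrow> summable (\<lambda>j. a i j * x j)"
    and "\<And>x. x \<in> lp_space p \<Longrightarrow> mat_apply a x \<in> lp_space q"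
    and "\<And>x. x \<in> lp_space p \<Longrightarrow> lp_norm q (mat_apply a x) \<le> C * lp_norm p x"
proof -
  obtain C where C: "\<And>x. x \<in> lp_space p \<Longrightarrow> lp_norm q (mat_apply a x) \<le> C * lp_norm p x"
    using assms(1) unfolding bounded_matrices_def by blast
  have "lp_norm q (mat_apply a x) \<le> max C 0 * lp_norm p x" if "x \<in> lp_space p" for x
    using C[OF that] mult_right_mono[OF max.cobounded1[of C 0] lp_norm_nonneg[OF assms(2) that]] by linarith
  then show ?thesis
    using assms(1) unfolding bounded_matrices_def by (intro that[of "max C 0"]) auto
qed

text \<open>Changing the phases of the entries of x preserves its l_r norm, so for a fixed row i all
  terms can be made nonnegative; one coordinate of the image is then bounded by its norm.\<close>

lemma bounded_matrices_row_abs: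
  assumes a: "a \<in> bounded_matrices r q" and r: "1 \<le> r" and q: "1 \<le> q"
  obtains C where "C \<ge> 0"
    and "\<And>x i. x \<in> lp_space r \<Longrightarrow> summable (\<lambda>j. norm (a i j * x j))"
    and "\<And>x i. x \<in> lp_space r \<Longrightarrow> (\<Sum>j. norm (a i j * x j)) \<le> C * lp_norm r x"
proof -
  obtain C where C: "C \<ge> 0"
    "\<And>x i. x \<in> lp_space r \<Longrightarrow> summable (\<lambda>j. a i j * x j)"
    "\<And>x. x \<in> lp_space r \<Longrightarrow> mat_apply a x \<in> lp_space q"
    "\<And>x. x \<in> lp_space r \<Longrightarrow> lp_norm q (mat_apply a x) \<le> C * lp_norm r x"
    using bounded_matricesE[OF a r] by blast
  have "summable (\<lambda>j. norm (a i j * x j)) \<and> (\<Sum>j. norm (a i j * x j)) \<le> C * lp_norm r x"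
    if x: "x \<in> lp_space r" for x i
  proof -
    \<comment> \<open>The value 1 at vanishing terms keeps w unimodular everywhere, so that
      \<open>w j * x j\<close> has exactly the norm of x.\<close>
    define w where "w = (\<lambda>j. if a i j * x j = 0 then 1 else cnj (sgn (a i j * x j)))"
    have w: "norm (w j) = 1" for j by (simp add: w_def norm_sgn)
    have aw: "a i j * (w j * x j) = of_real (norm (a i j * x j))" for j
    proof (cases "a i j * x j = 0")
      case False
      let ?z = "a i j * x j"
      have "a i j * (w j * x j) = ?z * cnj (sgn ?z)" using False by (simp add: w_def)
      also have "\<dots> = (?z * cnj ?z) / of_real (norm ?z)" by (simp add: sgn_eq)
      also have "\<dots> = of_real ((norm ?z)\<^sup>2 / norm ?z)"
        by (simp only: complex_norm_square[symmetric] of_real_divide)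
      finally show ?thesis by (simp only: power2_eq_square nonzero_mult_div_cancel_right) simp
    qed auto
    have norms: "norm (w j * x j) = norm (x j)" for j by (simp add: norm_mult w)
    have wl: "(\<lambda>j. w j * x j) \<in> lp_space r" "lp_norm r (\<lambda>j. w j * x j) = lp_norm r x"
      using x by (auto simp: lp_space_def lp_norm_def norms bounded_iff)
    have "summable (\<lambda>j. of_real (norm (a i j * x j)) :: complex)"
      using C(2)[OF wl(1), of i] by (simp only: aw)
    then have s: "summable (\<lambda>j. norm (a i j * x j))"
      by (simp only: summable_of_real_iff)
    have "mat_apply a (\<lambda>j. w j * x j) i = of_real (\<Sum>j. norm (a i j * x j))"
      unfolding mat_apply_def by (simp only: aw suminf_of_real[OF s])
    then have "(\<Sum>j. norm (a i j * x j)) \<le> norm (mat_apply a (\<lambda>j. w j * x j) i)"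
      by (metis abs_ge_self norm_of_real)
    also have "\<dots> \<le> lp_norm q (mat_apply a (\<lambda>j. w j * x j))"
      by (rule norm_le_lp_norm[OF q C(3)[OF wl(1)]])
    also have "\<dots> \<le> C * lp_norm r x" using C(4)[OF wl(1)] wl(2) by simp
    finally show ?thesis using s by blast
  qed
  then show ?thesis by (intro that[OF C(1)]) simp_all
qed

section \<open>Multipliers obtained from decay along rows or columns\<close>

text \<open>Every absolute row sum of a against x is at most C times the norm of x, so coordinate i
  of the new image is at most that multiple of c_i, and c lies in the target space.\<close>

lemma schur_multiplier_row_decay:
  fixes c :: "nat \<Rightarrow> real"
  assumes q: "1 \<le> q" and r: "1 \<le> r" and c: "(\<lambda>i. of_real (c i)) \<in> lp_space q"
    and m: "\<And>i j. norm (m i j) \<le> c i"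
  shows "m \<in> schur_multipliers r q"
proof -
  have c0: "0 \<le> c i" for i using m[of i 0] norm_ge_zero order_trans by blast
  have cle: "c i \<le> lp_norm q (\<lambda>i. of_real (c i))" for i
    using norm_le_lp_norm[OF q c, of i] c0 by simp
  have "(\<lambda>i j. m i j * a i j) \<in> bounded_matrices r q" if a: "a \<in> bounded_matrices r q" for a
  proof -
    obtain C where C: "C \<ge> 0"
      and row: "\<And>x i. x \<in> lp_space r \<Longrightarrow> summable (\<lambda>j. norm (a i j * x j))"
        "\<And>x i. x \<in> lp_space r \<Longrightarrow> (\<Sum>j. norm (a i j * x j)) \<le> C * lp_norm r x"
      using bounded_matrices_row_abs[OF a r q] by blast
    have le: "norm (m i j * a i j * x j) \<le> c i * norm (a i j * x j)" for i j x
      using mult_right_mono[OF m[of i j], of "norm (a i j * x j)"] by (simp add: norm_mult mult.assoc)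
    have s: "summable (\<lambda>j. norm (m i j * a i j * x j))" if "x \<in> lp_space r" for x i
      by (rule summable_comparison_test'[OF summable_mult[OF row(1)[OF that, of i], of "c i"], of 0])
        (use le in simp)
    have dom: "norm (mat_apply (\<lambda>i j. m i j * a i j) x i) \<le> C * lp_norm r x * norm (of_real (c i) :: complex)"
      if x: "x \<in> lp_space r" for x i
    proof -
      have "norm (mat_apply (\<lambda>i j. m i j * a i j) x i) \<le> (\<Sum>j. norm (m i j * a i j * x j))"
        unfolding mat_apply_def by (rule summable_norm[OF s[OF x]])
      also have "\<dots> \<le> (\<Sum>j. c i * norm (a i j * x j))"
        by (intro suminf_le le s x summable_mult row)
      also have "\<dots> = c i * (\<Sum>j. norm (a i j * x j))" by (intro suminf_mult row x)
      also have "\<dots> \<le> c i * (C * lp_norm r x)" by (intro mult_left_mono row x c0)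
      finally show ?thesis using c0 by (simp add: mult.commute)
    qed
    show ?thesis
    proof (rule bounded_matricesI[where C = "C * lp_norm q (\<lambda>i. of_real (c i))"])
      fix x assume x: "x \<in> lp_space r"
      show "summable (\<lambda>j. m i j * a i j * x j)" for i
        using s[OF x] by (rule summable_norm_cancel)
      have T: "0 \<le> C * lp_norm r x" using C lp_norm_nonneg[OF r x] by simp
      show "mat_apply (\<lambda>i j. m i j * a i j) x \<in> lp_space q"
        by (rule lp_dominated(1)[OF q c T dom[OF x]])
      show "lp_norm q (mat_apply (\<lambda>i j. m i j * a i j) x) \<le> C * lp_norm q (\<lambda>i. of_real (c i)) * lp_norm r x"
        using lp_dominated(2)[OF q c T dom[OF x]] by (simp add: mult_ac)
    qed
  qed
  moreover have "\<exists>B. \<forall>i j. norm (m i j) \<le> B"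
    using m cle order_trans by blast
  ultimately show ?thesis by (simp add: schur_multipliers_def)
qed

text \<open>The columns of a are images of unit vectors, hence have l_r norm at most K. The new
  image is dominated by the combination of their absolute values with weights c_j |x_j|, whose total
  is at most D times the norm of x. Stating duality of c through \<open>sc\<close> and
  \<open>c\<close> treats q = 1 together with q > 1.\<close>

lemma schur_multiplier_column_decay:
  fixes c :: "nat \<Rightarrow> real" and q r :: real
  assumes q: "1 \<le> q" and r: "1 \<le> r"
    and sc: "\<And>x. x \<in> lp_space (ereal q) \<Longrightarrow> summable (\<lambda>j. c j * norm (x j))"
    and c: "\<And>x. x \<in> lp_space (ereal q) \<Longrightarrow> (\<Sum>j. c j * norm (x j)) \<le> D * lp_norm (ereal q) x"
    and cB: "\<And>j. c j \<le> B"
    and m: "\<And>i j. norm (m i j) \<le> c j"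
  shows "m \<in> schur_multipliers (ereal q) (ereal r)"
proof -
  have c0: "0 \<le> c j" for j using m[of 0 j] norm_ge_zero order_trans by blast
  have q': "1 \<le> ereal q" and r': "1 \<le> ereal r" using q r by auto
  have "(\<lambda>i j. m i j * a i j) \<in> bounded_matrices (ereal q) (ereal r)"
    if a: "a \<in> bounded_matrices (ereal q) (ereal r)" for a
  proof -
    obtain K where K: "K \<ge> 0"
      "\<And>x. x \<in> lp_space (ereal q) \<Longrightarrow> mat_apply a x \<in> lp_space (ereal r)"
      "\<And>x. x \<in> lp_space (ereal q) \<Longrightarrow> lp_norm (ereal r) (mat_apply a x) \<le> K * lp_norm (ereal q) x"
      using bounded_matricesE[OF a q'] by metis
    have col: "(\<Sum>i<n. norm (a i j) powr r) \<le> K powr r" and aK: "norm (a i j) \<le> K" for n i j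
    proof -
      let ?e = "\<lambda>n. if n = j then 1 else 0 :: complex"
      have e: "?e \<in> lp_space (ereal q)" "lp_norm (ereal q) ?e = 1"
        using lp_unit_vector[of q j] q by auto
      have le: "lp_norm (ereal r) (mat_apply a ?e) \<le> K" using K(3)[OF e(1)] e(2) by simp
      show "norm (a i j) \<le> K"
        using norm_le_lp_norm[OF r' K(2)[OF e(1)], of i] le by (simp only: mat_apply_unit_vector)
      have "(\<Sum>i<n. norm (mat_apply a ?e i) powr r) \<le> lp_norm (ereal r) (mat_apply a ?e) powr r"
        using r by (intro lp_partial_sum_le K(2)[OF e(1)]) auto
      also have "\<dots> \<le> K powr r"
        using le r lp_norm_nonneg[OF r' K(2)[OF e(1)]] by (intro powr_mono2) auto
      finally show "(\<Sum>i<n. norm (a i j) powr r) \<le> K powr r" by (simp only: mat_apply_unit_vector)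
    qed
    have D0: "0 \<le> D * lp_norm (ereal q) x" if "x \<in> lp_space (ereal q)" for x
      using c[OF that] suminf_nonneg[OF sc[OF that]] c0 by simp
    show ?thesis
    proof (rule bounded_matricesI[where C = "D * K"])
      fix x assume x: "x \<in> lp_space (ereal q)"
      define \<tau> where "\<tau> = (\<lambda>j. c j * norm (x j))"
      have \<tau>0: "0 \<le> \<tau> j" for j using c0 by (simp add: \<tau>_def)
      have s\<tau>: "summable \<tau>" using sc[OF x] by (simp add: \<tau>_def)
      define T where "T = suminf \<tau>"
      have T: "0 \<le> T" "T \<le> D * lp_norm (ereal q) x"
        using c[OF x] suminf_nonneg[OF s\<tau> \<tau>0] by (auto simp: T_def \<tau>_def)
      have le: "norm (m i j * a i j * x j) \<le> \<tau> j * norm (a i j)" for i j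
        using mult_right_mono[OF m[of i j], of "norm (a i j * x j)"]
        by (simp add: norm_mult \<tau>_def mult_ac)
      have sb: "summable (\<lambda>j. \<tau> j * norm (a i j))" for i
        by (rule summable_comparison_test'[OF summable_mult2[OF s\<tau>, of K], of 0])
          (use aK \<tau>0 in \<open>simp add: mult_left_mono abs_mult\<close>)
      have sn: "summable (\<lambda>j. norm (m i j * a i j * x j))" for i
        by (rule summable_comparison_test'[OF sb[of i], of 0]) (use le in simp)
      show "summable (\<lambda>j. m i j * a i j * x j)" for i using sn by (rule summable_norm_cancel)
      \<comment> \<open>Truncating rows and columns makes the exchange of sums elementary. Jensen
        with weights \<tau> replaces the triangle inequality in l_r.\<close>
      have finite_le: "(\<Sum>i<M. (\<Sum>j<N. \<tau> j * norm (a i j)) powr r) \<le> (T * K) powr r" for M N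
      proof -
        define TN where "TN = (\<Sum>j<N. \<tau> j)"
        have TN: "0 \<le> TN" "TN \<le> T"
          unfolding TN_def T_def using \<tau>0 s\<tau> by (auto intro: sum_nonneg sum_le_suminf)
        have "(\<Sum>i<M. (\<Sum>j<N. \<tau> j * norm (a i j)) powr r) \<le>
            (\<Sum>i<M. TN powr (r - 1) * (\<Sum>j<N. \<tau> j * norm (a i j) powr r))"
          unfolding TN_def using r \<tau>0 by (intro sum_mono Jensen_powr_sum) auto
        also have "\<dots> = TN powr (r - 1) * (\<Sum>j<N. \<tau> j * (\<Sum>i<M. norm (a i j) powr r))"
          by (simp add: sum_distrib_left sum.swap[of _ "{..<M}"])
        also have "\<dots> \<le> TN powr (r - 1) * (\<Sum>j<N. \<tau> j * K powr r)"
          by (intro mult_left_mono sum_mono col \<tau>0) auto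
        also have "\<dots> = TN powr r * K powr r"
          using TN(1) by (cases "TN = 0") (auto simp: TN_def powr_diff simp flip: sum_distrib_right)
        also have "\<dots> \<le> T powr r * K powr r"
          using TN r by (intro mult_right_mono powr_mono2) auto
        finally show ?thesis using T K(1) by (simp add: powr_mult)
      qed
      \<comment> \<open>The column cutoff N tends to infinity with M fixed; the bound is uniform in
        M, as \<open>lp_boundI\<close> requires.\<close>
      have lim: "(\<Sum>i<M. (\<Sum>j. \<tau> j * norm (a i j)) powr r) \<le> (T * K) powr r" for M
      proof (rule LIMSEQ_le_const2)
        show "(\<lambda>N. \<Sum>i<M. (\<Sum>j<N. \<tau> j * norm (a i j)) powr r) \<longlonglongrightarrow>
            (\<Sum>i<M. (\<Sum>j. \<tau> j * norm (a i j)) powr r)"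
          using r \<tau>0 by (intro tendsto_sum tendsto_powr' summable_LIMSEQ[OF sb] tendsto_const)
            (auto intro!: always_eventually sum_nonneg)
      qed (use finite_le in auto)
      have bound: "(\<Sum>i<M. norm (mat_apply (\<lambda>i j. m i j * a i j) x i) powr r) \<le>
          (D * lp_norm (ereal q) x * K) powr r" for M
      proof -
        have "(\<Sum>i<M. norm (mat_apply (\<lambda>i j. m i j * a i j) x i) powr r) \<le>
            (\<Sum>i<M. (\<Sum>j. \<tau> j * norm (a i j)) powr r)"
        proof (intro sum_mono powr_mono2)
          fix i
          show "norm (mat_apply (\<lambda>i j. m i j * a i j) x i) \<le> (\<Sum>j. \<tau> j * norm (a i j))"
            unfolding mat_apply_def
            using summable_norm[OF sn[of i]] suminf_le[OF le sn sb, of i] by linarith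
        qed (use r in auto)
        also note lim[of M]
        also have "(T * K) powr r \<le> (D * lp_norm (ereal q) x * K) powr r"
          using T K(1) r by (intro powr_mono2 mult_right_mono) auto
        finally show ?thesis .
      qed
      have nn: "0 \<le> D * lp_norm (ereal q) x * K" using D0[OF x] K(1) by simp
      show "mat_apply (\<lambda>i j. m i j * a i j) x \<in> lp_space (ereal r)"
        using lp_boundI(1)[OF _ nn bound] r by simp
      show "lp_norm (ereal r) (mat_apply (\<lambda>i j. m i j * a i j) x) \<le> D * K * lp_norm (ereal q) x"
        using lp_boundI(2)[OF _ nn bound] r by (simp add: mult_ac)
    qed
  qed
  moreover have "\<exists>B. \<forall>i j. norm (m i j) \<le> B" using m cB order_trans by blast
  ultimately show ?thesis by (simp add: schur_multipliers_def)
qed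

section \<open>Duality between conjugate exponents\<close>

text \<open>The transposed image w of y is paired with a truncated norming vector z. Moving the
  matrix onto z gives S \<le> C ||y|| S^(1/p) for the partial sum S of |w|^p', and division by
  S^(1/p) leaves the bound.\<close>

lemma bounded_matrices_transpose:
  fixes p p' :: real
  assumes p: "p > 1" "p' > 1" "1/p + 1/p' = 1"
    and a: "a \<in> bounded_matrices (ereal p) (ereal p)"
  shows "(\<lambda>i j. a j i) \<in> bounded_matrices (ereal p') (ereal p')"
proof -
  have p1: "1 \<le> ereal p" and p'1: "1 \<le> ereal p'" using p by auto
  obtain C where C: "C \<ge> 0"
    "\<And>x i. x \<in> lp_space (ereal p) \<Longrightarrow> summable (\<lambda>j. a i j * x j)"
    "\<And>x. x \<in> lp_space (ereal p) \<Longrightarrow> mat_apply a x \<in> lp_space (ereal p)"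
    "\<And>x. x \<in> lp_space (ereal p) \<Longrightarrow> lp_norm (ereal p) (mat_apply a x) \<le> C * lp_norm (ereal p) x"
    using bounded_matricesE[OF a p1] by blast
  have holder: "summable (\<lambda>j. norm (x j * y j))"
    "(\<Sum>j. norm (x j * y j)) \<le> lp_norm (ereal p) x * lp_norm (ereal p') y"
    if "x \<in> lp_space (ereal p)" "y \<in> lp_space (ereal p')" for x y
    using Holder_suminf[OF p, of "\<lambda>j. norm (x j)" "\<lambda>j. norm (y j)"] that by (auto simp: norm_mult)
  have col: "(\<lambda>j. a j i) \<in> lp_space (ereal p)" for i
  proof -
    have "mat_apply a (\<lambda>n. if n = i then 1 else 0) \<in> lp_space (ereal p)"
      using p by (intro C(3) lp_unit_vector) auto
    then show ?thesis by (simp only: lp_space_ereal mat_apply_unit_vector)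
  qed
  have bound: "(\<Sum>i<N. norm (mat_apply (\<lambda>i j. a j i) y i) powr p') \<le> (C * lp_norm (ereal p') y) powr p'"
    if y: "y \<in> lp_space (ereal p')" for y N
  proof -
    define w where "w = mat_apply (\<lambda>i j. a j i) y"
    \<comment> \<open>The equality case of Hoelder: |z|^p = |w|^p' and z w = |w|^p' below N. The
      cutoff makes S finite before w is known to lie in l_p'.\<close>
    define z where "z = (\<lambda>i. if i < N then cnj (sgn (w i)) * of_real (norm (w i) powr (p' - 1)) else 0)"
    define S where "S = (\<Sum>i<N. norm (w i) powr p')"
    have S0: "S \<ge> 0" unfolding S_def by (intro sum_nonneg) auto
    have conj: "(p' - 1) * p = p'" using p by (simp add: field_simps)
    have nz: "norm (z i) powr p = (if i < N then norm (w i) powr p' else 0)" for i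
      by (simp add: z_def norm_mult norm_sgn powr_powr conj)
    have zs: "(\<lambda>i. norm (z i) powr p) sums S"
      unfolding S_def using sums_If_finite_set[of "{..<N}" "\<lambda>i. norm (w i) powr p'"] by (simp add: nz)
    then have zl: "z \<in> lp_space (ereal p)" by (simp add: sums_summable)
    have zn: "lp_norm (ereal p) z = S powr (1 / p)" using sums_unique[OF zs] by simp
    have zw: "z i * w i = of_real (norm (w i) powr p')" if "i < N" for i
    proof (cases "w i = 0")
      case False
      have "z i * w i = (w i * cnj (w i)) / of_real (norm (w i)) * of_real (norm (w i) powr (p' - 1))"
        using that by (simp add: z_def sgn_eq)
      also have "\<dots> = of_real (norm (w i) * norm (w i) powr (p' - 1))"
        using False by (simp add: complex_norm_square[symmetric] power2_eq_square)
      also have "norm (w i) * norm (w i) powr (p' - 1) = norm (w i) powr p'"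
        using False by (simp add: powr_diff)
      finally show ?thesis .
    qed simp
    have az: "mat_apply a z j = (\<Sum>i<N. a j i * z i)" for j
      unfolding mat_apply_def by (rule suminf_finite[of "{..<N}"]) (auto simp: z_def)
    have sy: "summable (\<lambda>j. a j i * y j)" for i
      using holder(1)[OF col[of i] y] by (rule summable_norm_cancel)
    have "of_real S = (\<Sum>i<N. z i * w i)" using zw by (simp add: S_def)
    also have "\<dots> = (\<Sum>i<N. \<Sum>j. z i * (a j i * y j))"
      unfolding w_def mat_apply_def by (intro sum.cong refl suminf_mult[symmetric] sy)
    also have "\<dots> = (\<Sum>j. \<Sum>i<N. z i * (a j i * y j))"
      by (intro suminf_sum[symmetric] summable_mult sy)
    also have "\<dots> = (\<Sum>j. mat_apply a z j * y j)"
      by (simp add: az sum_distrib_right sum_distrib_left mult_ac)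
    finally have "S = norm (\<Sum>j. mat_apply a z j * y j)" using S0 by (metis abs_of_nonneg norm_of_real)
    also have "\<dots> \<le> (\<Sum>j. norm (mat_apply a z j * y j))"
      by (rule summable_norm[OF holder(1)[OF C(3)[OF zl] y]])
    also have "\<dots> \<le> lp_norm (ereal p) (mat_apply a z) * lp_norm (ereal p') y"
      by (rule holder(2)[OF C(3)[OF zl] y])
    also have "\<dots> \<le> (C * lp_norm (ereal p) z) * lp_norm (ereal p') y"
      by (intro mult_right_mono C(4) zl lp_norm_nonneg[OF p'1 y])
    finally have *: "S \<le> C * lp_norm (ereal p') y * S powr (1 / p)"
      by (simp only: zn mult_ac)
    have CY: "0 \<le> C * lp_norm (ereal p') y" using C(1) lp_norm_nonneg[OF p'1 y] by simp
    have "S \<le> (C * lp_norm (ereal p') y) powr p'"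
    proof (cases "S = 0")
      case False
      \<comment> \<open>Now S^(1/p) can be divided out, and 1 - 1/p = 1/p'.\<close>
      with S0 have S: "S > 0" by simp
      have "S powr (1 / p') = S / S powr (1 / p)"
        using S p(3) by (metis add_diff_cancel_left' powr_diff powr_one S0)
      also have "\<dots> \<le> C * lp_norm (ereal p') y" using * S by (simp add: field_simps)
      finally have "(S powr (1 / p')) powr p' \<le> (C * lp_norm (ereal p') y) powr p'"
        using p by (intro powr_mono2) auto
      then show ?thesis using S p by (simp add: powr_powr)
    qed simp
    then show ?thesis by (simp only: S_def w_def)
  qed
  show ?thesis
  proof (rule bounded_matricesI[where C = C])
    fix y assume y: "y \<in> lp_space (ereal p')"
    show "summable (\<lambda>j. a j i * y j)" for i
      using holder(1)[OF col[of i] y] by (rule summable_norm_cancel)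
    have CY: "0 \<le> C * lp_norm (ereal p') y" using C(1) lp_norm_nonneg[OF p'1 y] by simp
    show "mat_apply (\<lambda>i j. a j i) y \<in> lp_space (ereal p')"
      using lp_boundI(1)[OF _ CY bound[OF y]] p by simp
    show "lp_norm (ereal p') (mat_apply (\<lambda>i j. a j i) y) \<le> C * lp_norm (ereal p') y"
      using lp_boundI(2)[OF _ CY bound[OF y]] p by simp
  qed
qed

subsection \<open>The sign matrix and the sign multiplier\<close>

lemma mat_apply_finite_row:
  assumes "\<And>j. n \<le> j \<Longrightarrow> a i j = 0"
  shows "summable (\<lambda>j. a i j * x j)" and "mat_apply a x i = (\<Sum>j<n. a i j * x j)"
proof -
  have *: "a i j * x j = 0" if "j \<notin> {..<n}" for j using assms that by simp
  show "summable (\<lambda>j. a i j * x j)" by (rule summable_finite[of "{..<n}", OF _ *]) auto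
  show "mat_apply a x i = (\<Sum>j<n. a i j * x j)"
    unfolding mat_apply_def by (rule suminf_finite[of "{..<n}", OF _ *]) auto
qed

lemma floor_log_power_add:
  assumes "i < 2 ^ n"
  shows "floor_log (2 ^ n + i) = n"
  using assms by (intro floor_log_eqI) auto

text \<open>
  Row \<open>i\<close> belongs to block \<open>n = floor_log i\<close>. The factor \<open>2\<^sup>-\<^sup>n\<^sup>/\<^sup>p\<close> normalises the \<open>2\<^sup>n\<close> rows of the block,
  and \<open>n\<^sup>-\<^sup>t\<close> with \<open>t = u + max 0 (1/2 - 1/p)\<close> and \<open>u > 1/p\<close> makes the \<open>p\<close>-th powers of the block norms
  summable.
\<close>

definition sign_matrix :: "real \<Rightarrow> real \<Rightarrow> nat \<Rightarrow> nat \<Rightarrow> complex" where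
  "sign_matrix p t i j = (if j < floor_log i
     then of_real (2 powr (- real (floor_log i) / p) * real (floor_log i) powr (- t) * sgn_bit i j) else 0)"

lemma sign_matrix_block:
  assumes "i < 2 ^ n" "j < n"
  shows "sign_matrix p t (2 ^ n + i) j = of_real (2 powr (- real n / p) * real n powr (- t) * sgn_bit i j)"
  using assms by (simp add: sign_matrix_def floor_log_power_add sgn_bit_def bit_power_add)

lemma sign_matrix_eq_0:
  assumes "i < 2 ^ n" "n \<le> j"
  shows "sign_matrix p t (2 ^ n + i) j = 0"
  using assms by (simp add: sign_matrix_def floor_log_power_add)

lemma powr_mult_powr_block:
  fixes p c :: real
  assumes "p > 0" "c \<ge> 0"
  shows "(2 powr (- real n / p) * c) powr p = c powr p / 2 ^ n"
proof -
  have "(2 powr (- real n / p)) powr p = 2 powr (- real n)" using assms by (simp add: powr_powr)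
  also have "\<dots> = 1 / 2 ^ n" by (simp add: powr_minus powr_realpow divide_inverse)
  finally show ?thesis using assms by (simp add: powr_mult)
qed

text \<open>On block n, the 2^n of Khintchine's inequality cancels against the normalisation and the
  loss n^(p \<beta>) from comparing l_2 with l_p cancels against the exponent \<beta>. What remains
  is n^(-p u), summable since p u > 1.\<close>

lemma sign_matrix_bounded:
  fixes p u \<beta> :: real
  assumes p: "p > 1" and u: "u > 1 / p" and \<beta>: "\<beta> = max 0 (1/2 - 1/p)"
  shows "sign_matrix p (u + \<beta>) \<in> bounded_matrices (ereal p) (ereal p)"
proof -
  let ?a = "sign_matrix p (u + \<beta>)"
  define K where "K = 2 powr (p + 1) * khintchine_const p"
  have K: "K \<ge> 0" by (simp add: K_def khintchine_const_def)
  have pu: "p * u > 1" using p u by (simp add: field_simps)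
  have s\<zeta>: "summable (\<lambda>n. real n powr (- (p * u)))" using pu by (simp add: summable_real_powr_iff)
  define \<zeta> where "\<zeta> = (\<Sum>n. real n powr (- (p * u)))"
  have \<zeta>: "\<zeta> \<ge> 0" unfolding \<zeta>_def by (intro suminf_nonneg s\<zeta>) auto
  have block: "(\<Sum>i<2 ^ n. norm (mat_apply ?a x (2 ^ n + i)) powr p)
      \<le> real n powr (- (p * u)) * (K * lp_norm (ereal p) x powr p)"
    if x: "x \<in> lp_space (ereal p)" for x n
  proof -
    define v where "v = real n powr (- (u + \<beta>))"
    have "(\<Sum>i<2 ^ n. norm (mat_apply ?a x (2 ^ n + i)) powr p) =
        (\<Sum>i<2 ^ n. v powr p / 2 ^ n * norm (\<Sum>j<n. of_real (sgn_bit i j) * x j) powr p)"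
    proof (intro sum.cong refl)
      fix i :: nat assume "i \<in> {..<2 ^ n}"
      then have i: "i < 2 ^ n" by simp
      have "mat_apply ?a x (2 ^ n + i) = (\<Sum>j<n. ?a (2 ^ n + i) j * x j)"
        using sign_matrix_eq_0[OF i] by (rule mat_apply_finite_row(2))
      also have "\<dots> = of_real (2 powr (- real n / p) * v) * (\<Sum>j<n. of_real (sgn_bit i j) * x j)"
        unfolding sum_distrib_left using i by (intro sum.cong) (auto simp: sign_matrix_block v_def mult_ac)
      finally have "norm (mat_apply ?a x (2 ^ n + i)) powr p =
          (2 powr (- real n / p) * v) powr p * norm (\<Sum>j<n. of_real (sgn_bit i j) * x j) powr p"
        by (simp add: norm_mult powr_mult v_def)
      then show "norm (mat_apply ?a x (2 ^ n + i)) powr p =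
          v powr p / 2 ^ n * norm (\<Sum>j<n. of_real (sgn_bit i j) * x j) powr p"
        using p by (subst (asm) powr_mult_powr_block) (auto simp: v_def)
    qed
    also have "\<dots> = v powr p / 2 ^ n * (\<Sum>i<2 ^ n. norm (\<Sum>j<n. of_real (sgn_bit i j) * x j) powr p)"
      by (rule sum_distrib_left[symmetric])
    also have "\<dots> \<le> v powr p / 2 ^ n * (K * 2 ^ n * (\<Sum>j<n. (norm (x j))\<^sup>2) powr (p / 2))"
      unfolding K_def using p by (intro mult_left_mono Khintchine_complex) auto
    also have "\<dots> = v powr p * K * (\<Sum>j<n. (norm (x j))\<^sup>2) powr (p / 2)" by simp
    also have "\<dots> \<le> v powr p * K * (real n powr (p * \<beta>) * (\<Sum>j<n. norm (x j) powr p))"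
      unfolding \<beta> using p K by (intro mult_left_mono sum_squares_powr_le) auto
    also have "\<dots> \<le> v powr p * K * (real n powr (p * \<beta>) * lp_norm (ereal p) x powr p)"
      using p K by (intro mult_left_mono lp_partial_sum_le x) auto
    also have "\<dots> = (v powr p * real n powr (p * \<beta>)) * (K * lp_norm (ereal p) x powr p)"
      by (simp only: mult_ac)
    also have "v powr p * real n powr (p * \<beta>) = real n powr (- (p * u))"
      by (simp add: v_def powr_powr algebra_simps flip: powr_add)
    finally show ?thesis .
  qed
  have bound: "(\<Sum>i<N. norm (mat_apply ?a x i) powr p) \<le> ((\<zeta> * K) powr (1 / p) * lp_norm (ereal p) x) powr p"
    if x: "x \<in> lp_space (ereal p)" for x N
  proof -
    \<comment> \<open>Row 0 belongs to no dyadic block; it is zero because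
      \<open>floor_log 0\<close> is 0.\<close>
    have "mat_apply ?a x 0 = 0"
      using mat_apply_finite_row(2)[of 0 ?a 0 x] by (simp add: sign_matrix_def)
    \<comment> \<open>The range is enlarged to 2^N so that it consists of row 0 and complete
      blocks.\<close>
    have "(\<Sum>i<N. norm (mat_apply ?a x i) powr p) \<le> (\<Sum>i<2 ^ N. norm (mat_apply ?a x i) powr p)"
      using less_exp[of N] by (intro sum_mono2) auto
    also have "\<dots> = (\<Sum>n<N. \<Sum>i<2 ^ n. norm (mat_apply ?a x (2 ^ n + i)) powr p)"
      by (subst sum_dyadic_blocks) (simp add: \<open>mat_apply ?a x 0 = 0\<close>)
    also have "\<dots> \<le> (\<Sum>n<N. real n powr (- (p * u)) * (K * lp_norm (ereal p) x powr p))"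
      by (intro sum_mono block x)
    also have "\<dots> \<le> \<zeta> * (K * lp_norm (ereal p) x powr p)"
      unfolding sum_distrib_right[symmetric] \<zeta>_def using K
      by (intro mult_right_mono sum_le_suminf s\<zeta>) auto
    also have "\<dots> = ((\<zeta> * K) powr (1 / p) * lp_norm (ereal p) x) powr p"
      using p K \<zeta> by (simp add: powr_mult powr_powr)
    finally show ?thesis .
  qed
  show ?thesis
  proof (rule bounded_matricesI[where C = "(\<zeta> * K) powr (1 / p)"])
    fix x assume x: "x \<in> lp_space (ereal p)"
    show "summable (\<lambda>j. ?a i j * x j)" for i
      by (rule mat_apply_finite_row(1)[of "floor_log i"]) (simp add: sign_matrix_def)
    have nn: "0 \<le> (\<zeta> * K) powr (1 / p) * lp_norm (ereal p) x"
      using lp_norm_nonneg[of "ereal p" x] x p by (intro mult_nonneg_nonneg) auto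
    show "mat_apply ?a x \<in> lp_space (ereal p)"
      using lp_boundI(1)[OF _ nn bound[OF x]] p by simp
    show "lp_norm (ereal p) (mat_apply ?a x) \<le> (\<zeta> * K) powr (1 / p) * lp_norm (ereal p) x"
      using lp_boundI(2)[OF _ nn bound[OF x]] p by simp
  qed
qed

section \<open>The multiplier that removes the cancellation\<close>

definition sign_multiplier :: "real \<Rightarrow> nat \<Rightarrow> nat \<Rightarrow> complex" where
  "sign_multiplier s i j = of_real (real (Suc j) powr (- s) * sgn_bit i j)"

lemma norm_sign_multiplier: "norm (sign_multiplier s i j) = real (Suc j) powr (- s)"
  by (simp add: sign_multiplier_def norm_mult del: of_nat_Suc)

text \<open>On the test vector (j+1)^(-u), every row of block n of the product is a sum of positive
  terms of size at least n^(-s-u), up to the weight of the block. Assumption \<open>e\<close> says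
  that the resulting block contribution n^(p (1 - s - 2u - \<beta>)) is at least 1/n, so the
  harmonic series would converge.\<close>

lemma sign_multiplier_unbounded:
  fixes p s u \<beta> :: real
  assumes p: "p > 1" and u: "u > 1 / p" and s: "s \<ge> 0"
    and e: "s + 2 * u + \<beta> \<le> 1 + 1 / p"
  shows "(\<lambda>i j. sign_multiplier s i j * sign_matrix p (u + \<beta>) i j) \<notin> bounded_matrices (ereal p) (ereal p)"
proof
  let ?b = "\<lambda>i j. sign_multiplier s i j * sign_matrix p (u + \<beta>) i j"
  assume b: "?b \<in> bounded_matrices (ereal p) (ereal p)"
  \<comment> \<open>The vector lies in l_p because p u > 1.\<close>
  define x :: "nat \<Rightarrow> complex" where "x = (\<lambda>j. of_real (real (Suc j) powr (- u)))"
  have "p * u > 1" using p u by (simp add: field_simps)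
  then have "summable (\<lambda>n. real n powr (- (p * u)))" by (simp add: summable_real_powr_iff)
  then have "summable (\<lambda>n. real (Suc n) powr (- (p * u)))" by (subst summable_Suc_iff)
  then have x: "x \<in> lp_space (ereal p)"
    by (simp add: x_def powr_powr mult.commute del: of_nat_Suc)
  then have bx: "mat_apply ?b x \<in> lp_space (ereal p)" using b by (simp add: bounded_matrices_def)
  define L where "L = lp_norm (ereal p) (mat_apply ?b x) powr p"
  have block: "real n powr (-1) \<le> (\<Sum>i<2 ^ n. norm (mat_apply ?b x (2 ^ n + i)) powr p)" for n
  proof (cases "n = 0")
    case False
    have "real n powr (-1) / 2 ^ n \<le> norm (mat_apply ?b x (2 ^ n + i)) powr p" if i: "i < 2 ^ n" for i
    proof -
      define R where "R = (\<Sum>j<n. real (Suc j) powr (- s - u))"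
      define v where "v = real n powr (- (u + \<beta>))"
      have vR: "0 \<le> v * R" unfolding v_def R_def by (intro mult_nonneg_nonneg sum_nonneg) auto
      have su: "s + u > 0" using s u p by (smt (verit) divide_pos_pos)
      have "real n * real n powr (- s - u) = (\<Sum>j<n. real n powr (- s - u))" by simp
      also have "\<dots> \<le> R"
        unfolding R_def using su by (intro sum_mono powr_mono2') auto
      finally have R: "real n powr (1 - s - u) \<le> R" using False by (simp add: powr_diff powr_minus powr_add field_simps)
      have "mat_apply ?b x (2 ^ n + i) = (\<Sum>j<n. ?b (2 ^ n + i) j * x j)"
        by (rule mat_apply_finite_row(2)) (simp add: sign_matrix_eq_0[OF i])
      also have "\<dots> = (\<Sum>j<n. of_real (2 powr (- real n / p) * v * real (Suc j) powr (- s - u)))"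
      proof (intro sum.cong refl)
        fix j assume "j \<in> {..<n}"
        then have j: "j < n" by simp
        have *: "sgn_bit (2 ^ n + i) j = sgn_bit i j" using i j by (simp add: sgn_bit_def bit_power_add)
        \<comment> \<open>The sign of the multiplier meets the equal sign of the matrix and their
          product is 1: all cancellation within the row disappears.\<close>
        have "?b (2 ^ n + i) j * x j = of_real (2 powr (- real n / p) * v *
            (real (Suc j) powr (- s) * real (Suc j) powr (- u)) * (sgn_bit i j * sgn_bit i j))"
          unfolding sign_matrix_block[OF i j] sign_multiplier_def x_def v_def *
          by (simp only: of_real_mult mult_ac)
        then show "?b (2 ^ n + i) j * x j = of_real (2 powr (- real n / p) * v * real (Suc j) powr (- s - u))"
          by (simp flip: powr_add del: of_nat_Suc)
      qed
      also have "\<dots> = of_real (2 powr (- real n / p) * (v * R))"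
        by (simp add: R_def sum_distrib_left mult.assoc del: of_nat_Suc)
      finally have "norm (mat_apply ?b x (2 ^ n + i)) = 2 powr (- real n / p) * (v * R)"
        using vR by (simp only: norm_of_real) simp
      then have eq: "norm (mat_apply ?b x (2 ^ n + i)) powr p = (v * R) powr p / 2 ^ n"
        using powr_mult_powr_block[OF _ vR, of p n] p by simp
      have "real n powr (- 1 / p) \<le> real n powr (1 - s - 2 * u - \<beta>)"
        using False e by (intro powr_mono) auto
      also have "\<dots> = v * real n powr (1 - s - u)"
        by (simp add: v_def algebra_simps flip: powr_add)
      also have "\<dots> \<le> v * R" using R by (intro mult_left_mono) (auto simp: v_def)
      finally have "(real n powr (- 1 / p)) powr p \<le> (v * R) powr p"
        using p by (intro powr_mono2) auto
      then have "real n powr (- 1) \<le> (v * R) powr p" using p by (simp add: powr_powr)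
      then show ?thesis unfolding eq by (intro divide_right_mono) auto
    qed
    then have "(\<Sum>i<(2 ^ n :: nat). real n powr (-1) / 2 ^ n) \<le>
        (\<Sum>i<2 ^ n. norm (mat_apply ?b x (2 ^ n + i)) powr p)"
      by (intro sum_mono) auto
    then show ?thesis by simp
  qed (auto intro: sum_nonneg)
  have "(\<Sum>n<N. real n powr (-1)) \<le> L" for N
  proof -
    have "(\<Sum>n<N. real n powr (-1)) \<le> (\<Sum>n<N. \<Sum>i<2 ^ n. norm (mat_apply ?b x (2 ^ n + i)) powr p)"
      by (intro sum_mono block)
    also have "\<dots> \<le> (\<Sum>i<2 ^ N. norm (mat_apply ?b x i) powr p)"
      by (subst sum_dyadic_blocks) simp
    also have "\<dots> \<le> L" unfolding L_def using p by (intro lp_partial_sum_le bx) auto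
    finally show ?thesis .
  qed
  then have "summable (\<lambda>n. real n powr (-1))" by (intro summableI_nonneg_bounded) auto
  then show False unfolding summable_real_powr_iff by simp
qed

lemma sign_multiplier_test:
  fixes p s :: real
  assumes p: "p > 1" and s: "0 \<le> s" "s < 1 - 1 / p" "s < 1 / 2"
  obtains a where "a \<in> bounded_matrices (ereal p) (ereal p)"
    and "(\<lambda>i j. sign_multiplier s i j * a i j) \<notin> bounded_matrices (ereal p) (ereal p)"
proof -
  define \<beta> where "\<beta> = max 0 (1/2 - 1/p)"
  \<comment> \<open>Chosen so that s + 2 (1/p + \<eta>) + \<beta> equals 1 + 1/p. Since 1 - 1/p -
    \<beta> = min (1 - 1/p) (1/2), the two upper bounds on s say precisely that \<eta> > 0.\<close>
  define \<eta> where "\<eta> = (1 - 1/p - \<beta> - s) / 2"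
  have "\<eta> > 0" using s by (auto simp: \<eta>_def \<beta>_def max_def)
  moreover have "s + 2 * (1/p + \<eta>) + \<beta> \<le> 1 + 1/p" by (simp add: \<eta>_def field_simps)
  ultimately show ?thesis
    using sign_matrix_bounded[OF p, of "1/p + \<eta>" \<beta>] sign_multiplier_unbounded[OF p, of "1/p + \<eta>" s \<beta>]
      s(1) \<beta>_def that by simp
qed

lemma summable_Suc_powr: "t > 1 \<Longrightarrow> summable (\<lambda>j. real (Suc j) powr (- t))"
  using summable_Suc_iff[of "\<lambda>j. real j powr (- t)"] by (simp add: summable_real_powr_iff)

text \<open>The weights (j+1)^(-s) define a bounded functional on l_q: for q = 1 they are bounded by
  1, and for q > 1 Hoelder applies because s q' > 1.\<close>

lemma sign_multiplier_schur:
  fixes q r s :: real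
  assumes q: "q \<ge> 1" and r: "r \<ge> 1" and s: "s > 1 - 1 / q"
  shows "sign_multiplier s \<in> schur_multipliers (ereal q) (ereal r)"
proof -
  have s0: "s > 0" using s q by (smt (verit) divide_le_eq_1)
  have le1: "real (Suc j) powr (- s) \<le> 1" for j
    using s0 powr_mono2'[of "- s" 1 "real (Suc j)"] by simp
  obtain D where D: "\<And>x. x \<in> lp_space (ereal q) \<Longrightarrow>
      summable (\<lambda>j. real (Suc j) powr (- s) * norm (x j)) \<and>
      (\<Sum>j. real (Suc j) powr (- s) * norm (x j)) \<le> D * lp_norm (ereal q) x"
  proof (cases "q = 1")
    case True
    have "summable (\<lambda>j. real (Suc j) powr (- s) * norm (x j)) \<and>
      (\<Sum>j. real (Suc j) powr (- s) * norm (x j)) \<le> 1 * lp_norm (ereal q) x"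
      if "x \<in> lp_space (ereal q)" for x
    proof -
      have sx: "summable (\<lambda>j. norm (x j))" using that True by simp
      have le: "real (Suc j) powr (- s) * norm (x j) \<le> norm (x j)" for j
        using mult_right_mono[OF le1[of j], of "norm (x j)"] by simp
      have sm: "summable (\<lambda>j. real (Suc j) powr (- s) * norm (x j))"
        by (rule summable_comparison_test'[OF sx, of 0]) (use le in simp)
      have "(\<Sum>j. real (Suc j) powr (- s) * norm (x j)) \<le> (\<Sum>j. norm (x j))"
        by (intro suminf_le le sm sx)
      also have "\<dots> = lp_norm (ereal q) x" using True sx by (simp add: suminf_nonneg)
      finally show ?thesis using sm by simp
    qed
    then show ?thesis by (rule that)
  next
    case False
    define q' where "q' = q / (q - 1)"
    have q': "q' > 1" "q > 1" "1 / q' + 1 / q = 1" using False q by (auto simp: q'_def field_simps)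
    have "s > 1 / q'" using s q'(3) by simp
    then have sq: "s * q' > 1" using q'(1) by (simp add: field_simps)
    have eq: "(\<lambda>j. (real (Suc j) powr (- s)) powr q') = (\<lambda>j. real (Suc j) powr (- (s * q')))"
      by (simp add: powr_powr)
    have sc: "summable (\<lambda>j. (real (Suc j) powr (- s)) powr q')"
      unfolding eq by (rule summable_Suc_powr[OF sq])
    have "summable (\<lambda>j. real (Suc j) powr (- s) * norm (x j)) \<and>
      (\<Sum>j. real (Suc j) powr (- s) * norm (x j)) \<le>
        (\<Sum>j. (real (Suc j) powr (- s)) powr q') powr (1 / q') * lp_norm (ereal q) x"
      if "x \<in> lp_space (ereal q)" for x
      using Holder_suminf[OF q' _ _ sc, of "\<lambda>j. norm (x j)"] that by (simp del: of_nat_Suc)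
    then show ?thesis by (rule that)
  qed
  show ?thesis
    by (rule schur_multiplier_column_decay[OF q r _ _ le1, where D = D])
      (use D in \<open>auto simp: norm_sign_multiplier\<close>)
qed

text \<open>After transposition the decay is along the row index, and (i+1)^(-s) lies in l_q: for
  finite q because s q > 1, for q = \<infinity> because s > 0 makes it bounded.\<close>

lemma sign_multiplier_transpose_schur:
  fixes q r :: ereal and s :: real
  assumes q: "q \<ge> 1" and r: "r \<ge> 1" and s: "s > 0" "\<And>t. q = ereal t \<Longrightarrow> s > 1 / t"
  shows "(\<lambda>i j. sign_multiplier s j i) \<in> schur_multipliers r q"
proof (rule schur_multiplier_row_decay[OF q r])
  show "norm (sign_multiplier s j i) \<le> real (Suc i) powr (- s)" for i j
    by (simp only: norm_sign_multiplier order_refl)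
  show "(\<lambda>i. of_real (real (Suc i) powr (- s))) \<in> lp_space q"
  proof (cases q)
    case (real t)
    then have "t \<ge> 1" using q by simp
    then have "s * t > 1" using s(2)[OF real] by (simp add: field_simps)
    then show ?thesis
      using summable_Suc_powr[of "s * t"] real by (simp add: powr_powr del: of_nat_Suc)
  next
    case PInf
    have "real (Suc j) powr (- s) \<le> 1" for j
      using s(1) powr_mono2'[of "- s" 1 "real (Suc j)"] by simp
    then show ?thesis using PInf by (auto simp: bounded_iff simp del: of_nat_Suc)
  qed (use q in auto)
qed

section \<open>Choice of the exponent s and the non-inclusions\<close>

text \<open>An exponent s strictly between 1 - 1/q and min (1 - 1/p) (1/2) makes
  \<open>sign_multiplier s\<close> a multiplier from l_q that fails on l_p. The interval is nonempty
  since q < p and q < 2.\<close>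

lemma schur_multipliers_not_subset_columns:
  fixes p q r :: real
  assumes q: "1 \<le> q" "q < 2" "q < p" and r: "1 \<le> r"
  shows "\<not> schur_multipliers (ereal q) (ereal r) \<subseteq> schur_multipliers (ereal p) (ereal p)"
proof -
  have "1 - 1 / q < min (1 - 1 / p) (1 / 2)" using q by (auto simp: min_def field_simps)
  then obtain s where s: "1 - 1 / q < s" "s < min (1 - 1 / p) (1 / 2)" using dense by blast
  have s0: "s \<ge> 0" using s(1) q by (smt (verit) divide_le_eq_1)
  have p: "p > 1" using q by simp
  obtain a where "a \<in> bounded_matrices (ereal p) (ereal p)"
    "(\<lambda>i j. sign_multiplier s i j * a i j) \<notin> bounded_matrices (ereal p) (ereal p)"
    using sign_multiplier_test[OF p s0] s(2) by auto
  then have "sign_multiplier s \<notin> schur_multipliers (ereal p) (ereal p)"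
    by (auto simp: schur_multipliers_def)
  with sign_multiplier_schur[OF q(1) r s(1)] show ?thesis by blast
qed

text \<open>The failure on l_p' is transposed to l_p. As 1 - 1/p' = 1/p, the admissible s lie
  strictly between 1/q (0 for q = \<infinity>) and min (1/p) (1/2).\<close>

lemma schur_multipliers_not_subset_rows:
  fixes p :: real and q r :: ereal
  assumes p: "1 < p" and q: "2 < q" "ereal p < q" and r: "1 \<le> r"
  shows "\<not> schur_multipliers r q \<subseteq> schur_multipliers (ereal p) (ereal p)"
proof -
  have "\<exists>s>0. s < min (1 / p) (1 / 2) \<and> (\<forall>t. q = ereal t \<longrightarrow> s > 1 / t)"
  proof (cases q)
    case (real t)
    with p q have t: "t > 2" "t > p" by auto
    then have "1 / t < min (1 / p) (1 / 2)" using p by (auto simp: min_def field_simps)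
    then obtain s where s: "1 / t < s" "s < min (1 / p) (1 / 2)" using dense by blast
    have "0 < 1 / t" using t by simp
    then have "0 < s" using s(1) by (rule less_trans)
    then show ?thesis using s real by (intro exI[of _ s]) auto
  next
    case PInf
    have "0 < min (1 / p) (1 / 2)" using p by simp
    then obtain s where "0 < s" "s < min (1 / p) (1 / 2)" using dense by blast
    then show ?thesis using PInf by auto
  qed (use q in auto)
  then obtain s where s: "s > 0" "s < 1 / p" "s < 1 / 2" "\<And>t. q = ereal t \<Longrightarrow> s > 1 / t" by auto
  define p' where "p' = p / (p - 1)"
  have p': "p' > 1" "1 / p + 1 / p' = 1" "1 / p' + 1 / p = 1" "1 - 1 / p' = 1 / p"
    using p by (auto simp: p'_def field_simps)
  obtain a where a: "a \<in> bounded_matrices (ereal p') (ereal p')"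
    "(\<lambda>i j. sign_multiplier s i j * a i j) \<notin> bounded_matrices (ereal p') (ereal p')"
    using sign_multiplier_test[OF p'(1), of s] s p'(4) by auto
  have "(\<lambda>i j. a j i) \<in> bounded_matrices (ereal p) (ereal p)"
    by (rule bounded_matrices_transpose[OF p'(1) p p'(3) a(1)])
  \<comment> \<open>Were this product bounded on l_p, transposing it back would bound the original
    product on l_p'.\<close>
  moreover have "(\<lambda>i j. sign_multiplier s j i * a j i) \<notin> bounded_matrices (ereal p) (ereal p)"
    using bounded_matrices_transpose[OF p p'(1,2)] a(2) by blast
  ultimately have "(\<lambda>i j. sign_multiplier s j i) \<notin> schur_multipliers (ereal p) (ereal p)"
    by (auto simp: schur_multipliers_def)
  moreover have "(\<lambda>i j. sign_multiplier s j i) \<in> schur_multipliers r q"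
  proof (rule sign_multiplier_transpose_schur[OF _ r s(1) s(4)])
    show "1 \<le> q" using q(1) by (cases q) auto
  qed
  ultimately show ?thesis by blast
qed

theorem proposition5p3:
  shows
    "(\<forall>p q :: ereal. 1 \<le> q \<and> q < p \<and> p \<le> 2 \<longrightarrow>
        \<not> schur_multipliers q 1 \<subseteq> schur_multipliers p p \<and>
        (\<forall>r. 1 \<le> r \<and> r \<le> q \<longrightarrow> \<not> schur_multipliers q r \<subseteq> schur_multipliers p p)) \<and>
     (\<forall>p q r :: ereal. 2 \<le> p \<and> p < q \<and> q \<le> r \<longrightarrow>
        \<not> schur_multipliers r q \<subseteq> schur_multipliers p p) \<and>
     (\<forall>p q :: ereal. (1 < q \<and> q < 2 \<and> 2 < p \<and> p < \<infinity>) \<or> (1 < p \<and> p < 2 \<and> 2 < q \<and> q < \<infinity>) \<longrightarrow>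
        \<not> schur_multipliers q q \<subseteq> schur_multipliers p p)"
proof (intro conjI allI impI)
  \<comment> \<open>Both claims of (i) are instances, the first with r = 1; all exponents here are
    finite.\<close>
  have i: "\<not> schur_multipliers q r \<subseteq> schur_multipliers p p"
    if "1 \<le> q \<and> q < p \<and> p \<le> 2" "1 \<le> r" "r \<le> q" for p q r :: ereal
    using that schur_multipliers_not_subset_columns[of "real_of_ereal q" "real_of_ereal p" "real_of_ereal r"]
    by (cases p; cases q; cases r) auto
  {
    fix p q :: ereal assume pq: "1 \<le> q \<and> q < p \<and> p \<le> 2"
    show "\<not> schur_multipliers q 1 \<subseteq> schur_multipliers p p" using i[OF pq, of 1] pq by simp
    show "\<not> schur_multipliers q r \<subseteq> schur_multipliers p p" if "1 \<le> r \<and> r \<le> q" for r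
      using i[OF pq] that by blast
  next
    fix p q r :: ereal assume pq: "2 \<le> p \<and> p < q \<and> q \<le> r"
    \<comment> \<open>The strict inequality p < q makes p finite, whereas q and r may be
      infinite.\<close>
    then obtain p0 where p0: "p = ereal p0" "2 \<le> p0" by (cases p) auto
    have "2 < q" using pq by (meson le_less_trans)
    moreover have "1 \<le> r" using pq p0
      by (cases r; cases q) auto
    ultimately show "\<not> schur_multipliers r q \<subseteq> schur_multipliers p p"
      using schur_multipliers_not_subset_rows[of p0 q r] pq p0 by auto
  next
    fix p q :: ereal
    assume "(1 < q \<and> q < 2 \<and> 2 < p \<and> p < \<infinity>) \<or> (1 < p \<and> p < 2 \<and> 2 < q \<and> q < \<infinity>)"
    then obtain p0 q0 where pq: "p = ereal p0" "q = ereal q0"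
      "(1 < q0 \<and> q0 < 2 \<and> 2 < p0) \<or> (1 < p0 \<and> p0 < 2 \<and> 2 < q0)"
      by (cases p; cases q) auto
    \<comment> \<open>The case q < 2 < p uses the column multiplier and the case p < 2 < q the
      transposed one, each with r = q.\<close>
    then show "\<not> schur_multipliers q q \<subseteq> schur_multipliers p p"
      using schur_multipliers_not_subset_columns[of q0 p0 q0] schur_multipliers_not_subset_rows[of p0 q q]
      by auto
  }
qed

end
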